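(* Let $X,Y,Z$ be topological spaces and let $f:X\to Y$ and $g:Y\to Z$ be continuous maps. (1) If there exists a continuous map $h:Y\to X$ such that $f\circ h\simeq 1_Y$, then $\mathrm{cat}(g\circ f)=\mathrm{cat}(g)$. (2) If there exists a continuous map $g':Z\to Y$ such that $g'\circ g\simeq 1_Y$, then $\mathrm{cat}(g\circ f)=\mathrm{cat}(f)$.
   Context: $\simeq$ denotes (free) homotopy of continuous maps and $1_Y$ the identity map of $Y$. A continuous map is null-homotopic if it is homotopic to a constant map. The category $\mathrm{cat}(f)$ of a continuous map $f:X\to Y$ is the least positive integer $n$ such that $X$ is a union of open subsets $U_1,\dots,U_n$ with each restriction $f_{|U_i}:U_i\to Y$ null-homotopic, and $\infty$ if no such integer exists. *)

theory Defs
  imports "HOL-Analysis.Analysis" "HOL-Library.Extended_Nat"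
begin

abbreviation homotopic_maps ::
  "'a topology \<Rightarrow> 'b topology \<Rightarrow> ('a \<Rightarrow> 'b) \<Rightarrow> ('a \<Rightarrow> 'b) \<Rightarrow> bool"
  where "homotopic_maps \<equiv> homotopic_with (\<lambda>_. True)"

text \<open>As in \<^const>\<open>contractible_space\<close>, the value \<open>c\<close> need not be restricted to \<open>topspace Y\<close>:
  homotopic maps are continuous maps from \<open>X\<close> to \<open>Y\<close>, so \<open>c \<in> topspace Y\<close> unless \<open>X\<close> is empty.
  The empty map counts as constant, also when \<open>Y\<close> is empty.\<close>

definition nullhomotopic_map :: "'a topology \<Rightarrow> 'b topology \<Rightarrow> ('a \<Rightarrow> 'b) \<Rightarrow> bool"
  where "nullhomotopic_map X Y f \<longleftrightarrow> (\<exists>c. homotopic_maps X Y f (\<lambda>_. c))"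

definition categorical_cover ::
  "'a topology \<Rightarrow> 'b topology \<Rightarrow> ('a \<Rightarrow> 'b) \<Rightarrow> nat \<Rightarrow> (nat \<Rightarrow> 'a set) \<Rightarrow> bool"
  where "categorical_cover X Y f n U \<longleftrightarrow>
    (\<forall>i\<in>{1..n}. openin X (U i) \<and> nullhomotopic_map (subtopology X (U i)) Y f) \<and>
    (\<Union>i\<in>{1..n}. U i) = topspace X"

text \<open>The infimum in \<^typ>\<open>enat\<close> is the least element of a nonempty set, and \<open>\<infinity>\<close> for the empty set.\<close>

definition map_cat :: "'a topology \<Rightarrow> 'b topology \<Rightarrow> ('a \<Rightarrow> 'b) \<Rightarrow> enat"
  where "map_cat X Y f = Inf {enat n | n. n \<ge> 1 \<and> (\<exists>U. categorical_cover X Y f n U)}"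

end

(* Precomposition pulls categorical covers back, postcomposition keeps them, and a homotopy
   of maps restricts to every member of a cover; so cat never grows under composition and is a
   homotopy invariant. Hence cat g = cat (g f h) <= cat (g f) <= cat g in part (1), and
   cat f = cat (g' g f) <= cat (g f) <= cat f in part (2). *)
theory Submission
  imports Defs
begin

text \<open>Restricting a map to \<open>S\<close> is precomposing it with the inclusion of the
  subspace, whose underlying function is \<open>id\<close>.\<close>

lemma homotopic_maps_subtopology:
  assumes "homotopic_maps X Y f f'"
  shows "homotopic_maps (subtopology X S) Y f f'"
proof -
  have "homotopic_maps (subtopology X S) Y (f \<circ> id) (f' \<circ> id)"
    using assms continuous_map_id_subt
    by (rule homotopic_with_compose_continuous_map_right) simp
  then show ?thesis
    by simp
qed

lemma nullhomotopic_map_homotopic: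
  assumes "homotopic_maps X Y f f'" "nullhomotopic_map X Y f'"
  shows "nullhomotopic_map X Y f"
  using assms unfolding nullhomotopic_map_def by (meson homotopic_with_trans)

lemma nullhomotopic_map_compose_right:
  assumes "nullhomotopic_map X Y f" "continuous_map W X h"
  shows "nullhomotopic_map W Y (f \<circ> h)"
proof -
  obtain c where "homotopic_maps X Y f (\<lambda>_. c)"
    using assms(1) unfolding nullhomotopic_map_def by blast
  then have "homotopic_maps W Y (f \<circ> h) ((\<lambda>_. c) \<circ> h)"
    using assms(2) by (rule homotopic_with_compose_continuous_map_right) simp
  then show ?thesis
    unfolding nullhomotopic_map_def by (auto simp: o_def)
qed

lemma nullhomotopic_map_compose_left:
  assumes "nullhomotopic_map X Y f" "continuous_map Y Z g"
  shows "nullhomotopic_map X Z (g \<circ> f)"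
proof -
  obtain c where "homotopic_maps X Y f (\<lambda>_. c)"
    using assms(1) unfolding nullhomotopic_map_def by blast
  then have "homotopic_maps X Z (g \<circ> f) (g \<circ> (\<lambda>_. c))"
    using assms(2) by (rule homotopic_with_compose_continuous_map_left) simp
  \<comment> \<open>The homotopy now ends at the constant map with value \<open>g c\<close>, which
    is the required witness.\<close>
  then show ?thesis
    unfolding nullhomotopic_map_def by (auto simp: o_def)
qed

text \<open>On the preimage of \<open>U i\<close>, the map \<open>f \<circ> h\<close> factors
  through the restriction of \<open>f\<close> to \<open>U i\<close>, so it inherits null-homotopy
  from that restriction.\<close>

lemma categorical_cover_compose_right:
  assumes "categorical_cover X Y f n U" "continuous_map W X h"
  shows "categorical_cover W Y (f \<circ> h) n (\<lambda>i. {x \<in> topspace W. h x \<in> U i})"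
proof -
  have "openin W {x \<in> topspace W. h x \<in> U i} \<and>
        nullhomotopic_map (subtopology W {x \<in> topspace W. h x \<in> U i}) Y (f \<circ> h)"
    if "i \<in> {1..n}" for i
  proof
    have U: "openin X (U i)" "nullhomotopic_map (subtopology X (U i)) Y f"
      using assms(1) that unfolding categorical_cover_def by auto
    show "openin W {x \<in> topspace W. h x \<in> U i}"
      using assms(2) U(1) by (rule openin_continuous_map_preimage)
    have "continuous_map (subtopology W {x \<in> topspace W. h x \<in> U i}) (subtopology X (U i)) h"
      using assms(2)
      by (auto simp: continuous_map_in_subtopology continuous_map_from_subtopology)
    with U(2) show "nullhomotopic_map (subtopology W {x \<in> topspace W. h x \<in> U i}) Y (f \<circ> h)"
      by (rule nullhomotopic_map_compose_right)
  qed
  \<comment> \<open>Since \<open>h\<close> sends \<open>topspace W\<close> into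
    \<open>topspace X\<close>, each image point lies in some \<open>U i\<close>.\<close>
  moreover have "(\<Union>i\<in>{1..n}. {x \<in> topspace W. h x \<in> U i}) = topspace W"
    using assms continuous_map_image_subset_topspace[OF assms(2)]
    unfolding categorical_cover_def by blast
  ultimately show ?thesis
    unfolding categorical_cover_def by blast
qed

lemma categorical_cover_compose_left:
  assumes "categorical_cover X Y f n U" "continuous_map Y Z g"
  shows "categorical_cover X Z (g \<circ> f) n U"
  using assms nullhomotopic_map_compose_left unfolding categorical_cover_def by blast

lemma categorical_cover_homotopic:
  assumes "homotopic_maps X Y f f'" "categorical_cover X Y f' n U"
  shows "categorical_cover X Y f n U"
  using assms nullhomotopic_map_homotopic[OF homotopic_maps_subtopology]
  unfolding categorical_cover_def by blast

text \<open>Turning covers into covers of the same size makes the set of sizes for \<open>f\<close>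
  a subset of that for \<open>f'\<close>, and an infimum over a larger set is smaller. A map without
  finite covers needs no separate case, as the infimum of the empty set is
  \<open>\<infinity>\<close>.\<close>

lemma map_cat_mono:
  assumes "\<And>n U. categorical_cover X Y f n U \<Longrightarrow> \<exists>V. categorical_cover X' Y' f' n V"
  shows "map_cat X' Y' f' \<le> map_cat X Y f"
  unfolding map_cat_def using assms by (intro Inf_superset_mono) blast

lemma map_cat_compose_right_le:
  assumes "continuous_map W X h"
  shows "map_cat W Y (f \<circ> h) \<le> map_cat X Y f"
  using categorical_cover_compose_right[OF _ assms] by (blast intro: map_cat_mono)

lemma map_cat_compose_left_le:
  assumes "continuous_map Y Z g"
  shows "map_cat X Z (g \<circ> f) \<le> map_cat X Y f"
  using categorical_cover_compose_left[OF _ assms] by (blast intro: map_cat_mono)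

lemma map_cat_homotopic:
  assumes "homotopic_maps X Y f f'"
  shows "map_cat X Y f = map_cat X Y f'"
proof (rule antisym)
  show "map_cat X Y f \<le> map_cat X Y f'"
    using categorical_cover_homotopic[OF assms] by (blast intro: map_cat_mono)
  have "homotopic_maps X Y f' f"
    using assms by (rule homotopic_with_symD)
  then show "map_cat X Y f' \<le> map_cat X Y f"
    using categorical_cover_homotopic by (blast intro: map_cat_mono)
qed

theorem mainTheorem10:
  fixes X :: "'a topology" and Y :: "'b topology" and Z :: "'c topology"
    and f :: "'a \<Rightarrow> 'b" and g :: "'b \<Rightarrow> 'c"
  assumes "continuous_map X Y f" and "continuous_map Y Z g"
  shows "((\<exists>h. continuous_map Y X h \<and> homotopic_maps Y Y (f \<circ> h) id)
            \<longrightarrow> map_cat X Z (g \<circ> f) = map_cat Y Z g)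
       \<and> ((\<exists>g'. continuous_map Z Y g' \<and> homotopic_maps Y Y (g' \<circ> g) id)
            \<longrightarrow> map_cat X Z (g \<circ> f) = map_cat X Y f)"
proof (intro conjI impI; elim exE conjE)
  fix h assume h: "continuous_map Y X h" "homotopic_maps Y Y (f \<circ> h) id"
  \<comment> \<open>Postcomposing the given homotopy with \<open>g\<close> deforms
    \<open>g \<circ> f \<circ> h\<close> to \<open>g\<close>; rebracketing then exhibits
    \<open>h\<close> as a precomposition of \<open>g \<circ> f\<close>.\<close>
  have "homotopic_maps Y Z (g \<circ> (f \<circ> h)) (g \<circ> id)"
    using h(2) assms(2) by (rule homotopic_with_compose_continuous_map_left) simp
  then have "map_cat Y Z g = map_cat Y Z ((g \<circ> f) \<circ> h)"
    by (simp add: map_cat_homotopic o_assoc)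
  also have "\<dots> \<le> map_cat X Z (g \<circ> f)"
    using h(1) by (rule map_cat_compose_right_le)
  \<comment> \<open>The opposite inequality comes from precomposing \<open>g\<close> with
    \<open>f\<close>.\<close>
  finally show "map_cat X Z (g \<circ> f) = map_cat Y Z g"
    using map_cat_compose_right_le[OF assms(1)] by (rule antisym[rotated])
next
  fix g' assume g': "continuous_map Z Y g'" "homotopic_maps Y Y (g' \<circ> g) id"
  \<comment> \<open>Dually, the homotopy is precomposed with \<open>f\<close>, and \<open>g'\<close>
    then acts by postcomposition on \<open>g \<circ> f\<close>.\<close>
  have "homotopic_maps X Y ((g' \<circ> g) \<circ> f) (id \<circ> f)"
    using g'(2) assms(1) by (rule homotopic_with_compose_continuous_map_right) simp
  then have "map_cat X Y f = map_cat X Y (g' \<circ> (g \<circ> f))"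
    by (simp add: map_cat_homotopic o_assoc)
  also have "\<dots> \<le> map_cat X Z (g \<circ> f)"
    using g'(1) by (rule map_cat_compose_left_le)
  finally show "map_cat X Z (g \<circ> f) = map_cat X Y f"
    using map_cat_compose_left_le[OF assms(2)] by (rule antisym[rotated])
qed

end
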